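(* Let $d\ge 1$ be an integer and let $0<\alpha<1$ be a real constant. For every integer $n>1$ let $F_n$ be a set of at most $2^{\alpha n^d}$ binary $d$-dimensional cubes with side $n$ (called forbidden cubes). Then there exist a number $L$ and a $d$-dimensional sequence $\omega\colon\mathbb{Z}^d\to\{0,1\}$ that does not contain any forbidden subcube with side greater than $L$; that is, for every $n>L$, no subcube of $\omega$ with side $n$ belongs to $F_n$.
   Context: A $d$-dimensional sequence is a function $\omega\colon\mathbb{Z}^d\to\{0,1\}$. A binary $d$-dimensional cube with side $n$ is a function $\{0,1,\ldots,n-1\}^d\to\{0,1\}$ (there are $2^{n^d}$ of them). A subcube of $\omega$ with side $n$ is the restriction of $\omega$ to a set of the form $[m_1,m_1+n)\times\cdots\times[m_d,m_d+n)\subset\mathbb{Z}^d$ with $m_1,\ldots,m_d\in\mathbb{Z}$, regarded up to translation, i.e. as the binary cube $(t_1,\ldots,t_d)\mapsto\omega(m_1+t_1,\ldots,m_d+t_d)$ with side $n$. *)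

theory Defs
  imports "HOL-Analysis.Finite_Cartesian_Product" "HOL-Library.FuncSet"
begin

text \<open>
  The dimension \<open>d\<close> is \<open>CARD('d)\<close> for a finite index type \<open>'d\<close>; it is at least 1 because
  types are nonempty. The alphabet \<open>{0, 1}\<close> is \<open>bool\<close>.
\<close>

type_synonym 'd dseq = "int ^ 'd \<Rightarrow> bool"

definition cube_box :: "nat \<Rightarrow> (int ^ 'd::finite) set" where
  "cube_box n = {t. \<forall>i. 0 \<le> t $ i \<and> t $ i < int n}"

text \<open>
  A cube is a function on the finite set \<open>cube_box n\<close>, represented extensionally
  (it is \<open>undefined\<close> elsewhere), so there are exactly \<open>2 ^ (n ^ d)\<close> cubes with side \<open>n\<close>.
\<close>

definition binary_cubes :: "nat \<Rightarrow> (int ^ 'd::finite \<Rightarrow> bool) set" where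
  "binary_cubes n = cube_box n \<rightarrow>\<^sub>E UNIV"

definition subcube :: "'d::finite dseq \<Rightarrow> nat \<Rightarrow> int ^ 'd \<Rightarrow> (int ^ 'd \<Rightarrow> bool)" where
  "subcube \<omega> n m = restrict (\<lambda>t. \<omega> (m + t)) (cube_box n)"

end

theory Submission
  imports Defs "HOL-Analysis.Analysis"
begin

text \<open>
  The proof counts good colourings instead of invoking the local lemma. Let \<open>C S\<close> be the set of
  colourings of a finite set \<open>S\<close> that contain no forbidden cube of side \<open>> L\<close>. For \<open>\<beta>\<close> with
  \<open>2 powr \<alpha> < \<beta> < 2\<close> one shows \<open>|C (insert x S)| \<ge> \<beta> |C S|\<close> by induction on \<open>|S|\<close>: of the \<open>2 |C S|\<close>
  extensions, those spoiled by a given cube \<open>A\<close> through \<open>x\<close> are determined by a forbidden pattern on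
  \<open>A\<close> and an element of \<open>C (S - A)\<close>, and \<open>|C (S - A)| \<le> |C S| / \<beta> ^ (|A| - 1)\<close> by induction. Since
  \<open>n ^ d\<close> cubes of side \<open>n\<close> pass through \<open>x\<close>, it suffices that the tail
  \<open>\<Sum>n>L. n ^ d * 2 powr (\<alpha> n ^ d) / \<beta> ^ (n ^ d - 1)\<close> is at most \<open>2 - \<beta>\<close>. Compactness of the space
  of sequences then handles all cubes at once.
\<close>

section \<open>Counting colourings that avoid local patterns\<close>

text \<open>Regions \<open>A j\<close> and pattern sets \<open>P j\<close> are indexed abstractly,
  so the counting uses no geometry. A region counts only once it lies wholly inside
  \<open>S\<close>.\<close>

definition good_colourings ::
    "'j set \<Rightarrow> ('j \<Rightarrow> 'a set) \<Rightarrow> ('j \<Rightarrow> ('a \<Rightarrow> bool) set) \<Rightarrow> 'a set \<Rightarrow> ('a \<Rightarrow> bool) set" where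
  "good_colourings J A P S =
     {f \<in> S \<rightarrow>\<^sub>E UNIV. \<forall>j\<in>J. A j \<subseteq> S \<longrightarrow> restrict f (A j) \<notin> P j}"

lemma finite_good_colourings: "finite S \<Longrightarrow> finite (good_colourings J A P S)"
  unfolding good_colourings_def
  by (rule finite_subset[of _ "S \<rightarrow>\<^sub>E UNIV"]) (auto intro: finite_PiE)

lemma restrict_good_colourings:
  assumes "f \<in> good_colourings J A P S" "T \<subseteq> S"
  shows "restrict f T \<in> good_colourings J A P T"
  using assms unfolding good_colourings_def
  by (auto simp: Int_absorb1 restrict_restrict)

lemma card_extensions:
  assumes "x \<notin> S" "G \<subseteq> S \<rightarrow>\<^sub>E UNIV"
  shows "card {g \<in> insert x S \<rightarrow>\<^sub>E (UNIV :: bool set). restrict g S \<in> G} = 2 * card G"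
proof -
  have "bij_betw (\<lambda>(b, f). f(x := b)) (UNIV \<times> G)
          {g \<in> insert x S \<rightarrow>\<^sub>E (UNIV :: bool set). restrict g S \<in> G}"
  proof (rule bij_betw_byWitness[where f' = "\<lambda>g. (g x, restrict g S)"])
    have restr: "restrict (f(x := b)) S = f" if "f \<in> G" for f b
      using that assms by (auto simp: fun_eq_iff restrict_def PiE_def extensional_def)
    show "\<forall>a\<in>UNIV \<times> G. (((case a of (b, f) \<Rightarrow> f(x := b)) x,
            restrict (case a of (b, f) \<Rightarrow> f(x := b)) S)) = a"
      using restr by auto
    show "\<forall>g\<in>{g \<in> insert x S \<rightarrow>\<^sub>E UNIV. restrict g S \<in> G}.
            (case (g x, restrict g S) of (b, f) \<Rightarrow> f(x := b)) = g"
      by (auto simp: fun_eq_iff restrict_def PiE_def extensional_def)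
    show "(\<lambda>(b, f). f(x := b)) ` (UNIV \<times> G) \<subseteq> {g \<in> insert x S \<rightarrow>\<^sub>E UNIV. restrict g S \<in> G}"
      using restr assms by (auto simp: PiE_def extensional_def subset_iff)
  qed auto
  from bij_betw_same_card[OF this] show ?thesis
    by (simp add: card_cartesian_product)
qed

text \<open>Union bound over the regions through \<open>x\<close>: an extension of a good colouring
  of \<open>S\<close> can only be violated at a region containing \<open>x\<close>, because a
  violation elsewhere would already occur in \<open>S\<close>.\<close>

lemma good_colourings_extend:
  assumes fin: "finite S" and x: "x \<notin> S" and J: "finite J"
    and finP: "\<And>j. j \<in> J \<Longrightarrow> finite (P j)"
  shows "2 * card (good_colourings J A P S) \<le> card (good_colourings J A P (insert x S)) +
    (\<Sum>j | j \<in> J \<and> x \<in> A j \<and> A j \<subseteq> insert x S.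
       card (P j) * card (good_colourings J A P (insert x S - A j)))"
proof -
  define E where E: "E = {g \<in> insert x S \<rightarrow>\<^sub>E UNIV. restrict g S \<in> good_colourings J A P S}"
  have ext: "card E = 2 * card (good_colourings J A P S)"
    unfolding E by (rule card_extensions[OF x]) (auto simp: good_colourings_def)
  define K where "K = {j. j \<in> J \<and> x \<in> A j \<and> A j \<subseteq> insert x S}"
  define bad where "bad j = {g \<in> E. restrict g (A j) \<in> P j}" for j
  have K: "finite K"
    using J by (simp add: K_def)
  have finE: "finite E"
    unfolding E by (rule finite_subset[of _ "insert x S \<rightarrow>\<^sub>E UNIV"]) (use fin in \<open>auto intro: finite_PiE\<close>)
  have card_bad: "card (bad j) \<le> card (P j) * card (good_colourings J A P (insert x S - A j))"
    if "j \<in> K" for j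
  proof -
    \<comment> \<open>A spoiled extension is encoded by its pattern on \<open>A j\<close> and the
      remainder off \<open>A j\<close>. The remainder lies in \<open>S\<close> because
      \<open>x\<close> is in \<open>A j\<close>, so it inherits goodness.\<close>
    let ?\<phi> = "\<lambda>g. (restrict g (A j), restrict g (insert x S - A j))"
    have j: "j \<in> J" "x \<in> A j" "A j \<subseteq> insert x S"
      using that by (auto simp: K_def)
    have inj: "inj_on ?\<phi> (bad j)"
    proof (rule inj_onI)
      fix g h assume gh: "g \<in> bad j" "h \<in> bad j" and eq: "?\<phi> g = ?\<phi> h"
      show "g = h"
      proof (rule PiE_ext[of _ "insert x S" "\<lambda>_. UNIV"])
        fix y assume "y \<in> insert x S"
        moreover have "restrict g (A j) y = restrict h (A j) y"
            "restrict g (insert x S - A j) y = restrict h (insert x S - A j) y"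
          using eq by simp_all
        ultimately show "g y = h y"
          by (cases "y \<in> A j") simp_all
      qed (use gh in \<open>auto simp: bad_def E\<close>)
    qed
    have "?\<phi> ` bad j \<subseteq> P j \<times> good_colourings J A P (insert x S - A j)"
    proof -
      have "restrict g (insert x S - A j) \<in> good_colourings J A P (insert x S - A j)" if "g \<in> bad j" for g
      proof -
        have sub: "insert x S - A j \<subseteq> S"
          using j by auto
        have "restrict g S \<in> good_colourings J A P S"
          using that by (simp add: bad_def E)
        from restrict_good_colourings[OF this sub] sub show ?thesis
          by (simp add: restrict_restrict Int_absorb1)
      qed
      then show ?thesis
        by (auto simp: bad_def)
    qed
    moreover have "finite (P j \<times> good_colourings J A P (insert x S - A j))"
      using fin finP[OF j(1)] by (auto intro!: finite_good_colourings)
    ultimately have "card (bad j) \<le> card (P j \<times> good_colourings J A P (insert x S - A j))"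
      by (rule card_inj_on_le[OF inj])
    then show ?thesis
      by (simp add: card_cartesian_product)
  qed
  have "E \<subseteq> good_colourings J A P (insert x S) \<union> (\<Union>j\<in>K. bad j)"
  proof
    fix g assume g: "g \<in> E"
    show "g \<in> good_colourings J A P (insert x S) \<union> (\<Union>j\<in>K. bad j)"
    proof (rule ccontr)
      assume neg: "\<not> ?thesis"
      then obtain j where j: "j \<in> J" "A j \<subseteq> insert x S" "restrict g (A j) \<in> P j"
        using g by (auto simp: good_colourings_def E)
      then have "x \<notin> A j"
        using neg g by (auto simp: K_def bad_def)
      then have "A j \<subseteq> S"
        using j by auto
      then have "restrict (restrict g S) (A j) \<notin> P j"
        using g j by (auto simp: E good_colourings_def)
      then show False
        using j \<open>A j \<subseteq> S\<close> by (simp add: restrict_restrict Int_absorb1)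
    qed
  qed
  then have "card E \<le> card (good_colourings J A P (insert x S) \<union> (\<Union>j\<in>K. bad j))"
    using fin K finE by (intro card_mono) (auto simp: bad_def intro!: finite_good_colourings)
  also have "\<dots> \<le> card (good_colourings J A P (insert x S)) + card (\<Union>j\<in>K. bad j)"
    by (rule card_Un_le)
  also have "card (\<Union>j\<in>K. bad j) \<le> (\<Sum>j\<in>K. card (bad j))"
    by (rule card_UN_le[OF K])
  also have "\<dots> \<le> (\<Sum>j\<in>K. card (P j) * card (good_colourings J A P (insert x S - A j)))"
    by (rule sum_mono[OF card_bad])
  finally show ?thesis
    using ext by (simp add: K_def)
qed

text \<open>The one-point growth is iterated to arbitrary \<open>T \<subseteq> S\<close> so that the
  induction hypothesis also covers the removal of a whole region. It is used twice: to bound the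
  loss at each region through \<open>x\<close>, and to pass from \<open>T\<close> to
  \<open>U\<close>.\<close>

lemma card_good_colourings_growth:
  fixes \<beta> :: real and P :: "'j \<Rightarrow> ('a \<Rightarrow> bool) set"
  assumes J: "finite J" and finP: "\<And>j. j \<in> J \<Longrightarrow> finite (P j)" and \<beta>: "0 < \<beta>"
    and small: "\<And>x. \<beta> + (\<Sum>j | j \<in> J \<and> x \<in> A j. real (card (P j)) / \<beta> ^ (card (A j) - 1)) \<le> 2"
    and "finite S" "T \<subseteq> S"
  shows "\<beta> ^ card (S - T) * real (card (good_colourings J A P T)) \<le> real (card (good_colourings J A P S))"
  using assms(5,6)
proof (induction "card S" arbitrary: S T rule: less_induct)
  case less
  let ?c = "\<lambda>S. real (card (good_colourings J A P S))"
  show ?case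
  proof (cases "T = S")
    case False
    then obtain x where x: "x \<in> S" "x \<notin> T"
      using less.prems by auto
    define U where "U = S - {x}"
    have U: "finite U" "x \<notin> U" "S = insert x U" "T \<subseteq> U"
      using less.prems x by (auto simp: U_def)
    have card_U: "card U < card S"
      using less.prems x unfolding U_def by (intro card_Diff1_less)
    let ?K = "{j. j \<in> J \<and> x \<in> A j \<and> A j \<subseteq> insert x U}"
    let ?K' = "{j. j \<in> J \<and> x \<in> A j}"
    have term_le: "real (card (P j)) * ?c (insert x U - A j)
            \<le> real (card (P j)) / \<beta> ^ (card (A j) - 1) * ?c U" if j: "j \<in> ?K" for j
    proof -
      have "insert x U - A j \<subseteq> U"
        using j by auto
      from less.hyps[OF card_U U(1) this]
      have "\<beta> ^ card (U - (insert x U - A j)) * ?c (insert x U - A j) \<le> ?c U" .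
      \<comment> \<open>Of the points of \<open>A j\<close>, only \<open>x\<close> is missing from
        \<open>U\<close>; this is the source of the exponent \<open>card (A j) - 1\<close>.\<close>
      moreover have "U - (insert x U - A j) = A j - {x}"
        using j U by auto
      moreover have "card (A j - {x}) = card (A j) - 1"
        using j by simp
      ultimately have "\<beta> ^ (card (A j) - 1) * ?c (insert x U - A j) \<le> ?c U"
        by simp
      then have "?c (insert x U - A j) \<le> ?c U / \<beta> ^ (card (A j) - 1)"
        using \<beta> by (simp add: field_simps)
      then have "real (card (P j)) * ?c (insert x U - A j) \<le> real (card (P j)) * (?c U / \<beta> ^ (card (A j) - 1))"
        by (rule mult_left_mono) simp
      then show ?thesis
        by simp
    qed
    from good_colourings_extend[OF U(1,2) J finP]
    have "2 * card (good_colourings J A P U) \<le> card (good_colourings J A P (insert x U)) +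
        (\<Sum>j\<in>?K. card (P j) * card (good_colourings J A P (insert x U - A j)))"
      by simp
    then have "2 * ?c U \<le> ?c (insert x U) + (\<Sum>j\<in>?K. real (card (P j)) * ?c (insert x U - A j))"
      by (simp only: of_nat_le_iff[where 'a = real, symmetric] of_nat_add of_nat_mult of_nat_sum of_nat_numeral)
    also have "(\<Sum>j\<in>?K. real (card (P j)) * ?c (insert x U - A j))
        \<le> (\<Sum>j\<in>?K. real (card (P j)) / \<beta> ^ (card (A j) - 1) * ?c U)"
      by (rule sum_mono[OF term_le])
    \<comment> \<open>The terms are nonnegative, so the condition that the region fits into
      \<open>insert x U\<close> may be dropped; the sum is then the one bounded by
      \<open>small\<close>.\<close>
    also have "\<dots> \<le> (\<Sum>j\<in>?K'. real (card (P j)) / \<beta> ^ (card (A j) - 1) * ?c U)"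
      by (rule sum_mono2) (use J \<beta> in auto)
    also have "\<dots> = (\<Sum>j\<in>?K'. real (card (P j)) / \<beta> ^ (card (A j) - 1)) * ?c U"
      by (simp add: sum_distrib_right)
    also have "\<dots> \<le> (2 - \<beta>) * ?c U"
      using small[of x] by (intro mult_right_mono) auto
    finally have step: "\<beta> * ?c U \<le> ?c S"
      using U by (simp add: algebra_simps)
    have "\<beta> ^ card (U - T) * ?c T \<le> ?c U"
      by (rule less.hyps[OF card_U U(1,4)])
    then have "\<beta> * (\<beta> ^ card (U - T) * ?c T) \<le> \<beta> * ?c U"
      using \<beta> by (intro mult_left_mono) auto
    moreover have "card (S - T) = Suc (card (U - T))"
      using U x by (simp add: insert_Diff_if)
    ultimately show ?thesis
      using step by simp
  qed simp
qed

lemma exists_avoiding_colouring: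
  fixes \<beta> :: real and P :: "'j \<Rightarrow> ('a \<Rightarrow> bool) set"
  assumes J: "finite J" and A: "\<And>j. j \<in> J \<Longrightarrow> finite (A j) \<and> A j \<noteq> {}"
    and finP: "\<And>j. j \<in> J \<Longrightarrow> finite (P j)" and \<beta>: "0 < \<beta>"
    and small: "\<And>x. \<beta> + (\<Sum>j | j \<in> J \<and> x \<in> A j. real (card (P j)) / \<beta> ^ (card (A j) - 1)) \<le> 2"
  shows "\<exists>f. \<forall>j\<in>J. restrict f (A j) \<notin> P j"
proof -
  let ?S = "\<Union>j\<in>J. A j"
  \<comment> \<open>Since every region is nonempty, none fits into the empty set, and the single
    empty colouring is good. Growth from there to the union of all regions, where every constraint
    is active, keeps the count positive.\<close>
  have "good_colourings J A P {} = {\<lambda>_. undefined}"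
    using A by (auto simp: good_colourings_def)
  moreover have "\<beta> ^ card (?S - {}) * real (card (good_colourings J A P {}))
      \<le> real (card (good_colourings J A P ?S))"
    using J A by (intro card_good_colourings_growth[OF J finP \<beta> small]) auto
  ultimately have "\<beta> ^ card ?S \<le> real (card (good_colourings J A P ?S))"
    by simp
  then have "0 < real (card (good_colourings J A P ?S))"
    using zero_less_power[OF \<beta>] by (rule less_le_trans[rotated])
  then obtain f where "f \<in> good_colourings J A P ?S"
    by (metis card.empty ex_in_conv of_nat_0 order_less_irrefl)
  then have "\<forall>j\<in>J. restrict f (A j) \<notin> P j"
    by (auto simp: good_colourings_def)
  then show ?thesis
    by (rule exI[of _ f])
qed

section \<open>Cubes in the integer lattice\<close>

lemma bij_betw_cube_box:
  "bij_betw (\<lambda>t. ($) t) (cube_box n :: (int ^ 'd::finite) set) (UNIV \<rightarrow>\<^sub>E {0..<int n})"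
  by (rule bij_betw_byWitness[where f' = vec_lambda]) (auto simp: cube_box_def)

lemma card_cube_box: "card (cube_box n :: (int ^ 'd::finite) set) = n ^ CARD('d)"
  using bij_betw_same_card[OF bij_betw_cube_box[of n, where 'd = 'd]] by (simp add: card_PiE)

lemma finite_cube_box: "finite (cube_box n :: (int ^ 'd::finite) set)"
  using bij_betw_finite[OF bij_betw_cube_box[of n, where 'd = 'd]] by (simp add: finite_PiE)

lemma finite_binary_cubes: "finite (binary_cubes n :: (int ^ 'd::finite \<Rightarrow> bool) set)"
  unfolding binary_cubes_def by (intro finite_PiE finite_cube_box) simp

definition cube_at :: "nat \<Rightarrow> int ^ 'd::finite \<Rightarrow> (int ^ 'd) set" where
  "cube_at n m = (+) m ` cube_box n"

lemma card_cube_at: "card (cube_at n m :: (int ^ 'd::finite) set) = n ^ CARD('d)"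
  unfolding cube_at_def by (simp add: card_image card_cube_box)

text \<open>A cube through \<open>x\<close> is determined by the offset \<open>t\<close> of
  \<open>x\<close> from its corner, which is then \<open>x - t\<close>. Hence there are as many such
  cubes as points in the box.\<close>

lemma cubes_through: "{m. x \<in> cube_at n m} = (\<lambda>t. x - t) ` cube_box n"
  by (auto simp: cube_at_def image_iff algebra_simps intro: bexI[rotated])

lemma card_cubes_through: "card {m :: int ^ 'd::finite. x \<in> cube_at n m} = n ^ CARD('d)"
  unfolding cubes_through by (simp add: card_image inj_on_def card_cube_box)

lemma finite_cubes_through: "finite {m. x \<in> cube_at n m}"
  unfolding cubes_through by (simp add: finite_cube_box)

text \<open>Forbidden cubes are anchored at the origin, whereas the counting argument restricts
  colourings in place; this moves \<open>C\<close> to the cube with corner \<open>m\<close>.\<close>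

definition patterns_at ::
    "(int ^ 'd::finite \<Rightarrow> bool) set \<Rightarrow> nat \<Rightarrow> int ^ 'd \<Rightarrow> (int ^ 'd \<Rightarrow> bool) set" where
  "patterns_at C n m = {f \<in> cube_at n m \<rightarrow>\<^sub>E UNIV. subcube f n m \<in> C}"

lemma subcube_in_iff: "subcube f n m \<in> C \<longleftrightarrow> restrict f (cube_at n m) \<in> patterns_at C n m"
proof -
  have "subcube (restrict f (cube_at n m)) n m = subcube f n m"
    by (auto simp: subcube_def cube_at_def restrict_def fun_eq_iff)
  then show ?thesis
    by (auto simp: patterns_at_def)
qed

lemma inj_on_subcube: "inj_on (\<lambda>f. subcube f n m) (cube_at n (m :: int ^ 'd::finite) \<rightarrow>\<^sub>E UNIV)"
proof (rule inj_onI)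
  fix f g :: "int ^ 'd \<Rightarrow> bool"
  assume fg: "f \<in> cube_at n m \<rightarrow>\<^sub>E UNIV" "g \<in> cube_at n m \<rightarrow>\<^sub>E UNIV"
    and eq: "subcube f n m = subcube g n m"
  show "f = g"
  proof (rule PiE_ext[OF fg])
    fix y assume "y \<in> cube_at n m"
    then obtain t where "y = m + t" "t \<in> cube_box n"
      by (auto simp: cube_at_def)
    then show "f y = g y"
      using fun_cong[OF eq, of t] by (simp add: subcube_def)
  qed
qed

lemma patterns_at_card_le:
  assumes "finite C"
  shows "finite (patterns_at C n m)" "card (patterns_at C n m) \<le> card C"
proof -
  have inj: "inj_on (\<lambda>f. subcube f n m) (patterns_at C n m)"
    by (rule inj_on_subset[OF inj_on_subcube]) (auto simp: patterns_at_def)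
  have "(\<lambda>f. subcube f n m) ` patterns_at C n m \<subseteq> C"
    by (auto simp: patterns_at_def)
  then show "finite (patterns_at C n m)" "card (patterns_at C n m) \<le> card C"
    using assms inj by (auto intro: inj_on_finite card_inj_on_le)
qed

section \<open>Compactness and the choice of the threshold\<close>

text \<open>Whether a subcube is forbidden depends on finitely many coordinates, so containing one
  is an open condition: the cylinder \<open>?T\<close> fixing \<omega> on that cube is a
  neighbourhood.\<close>

lemma closedin_avoiding:
  "closedin (product_topology (\<lambda>_. discrete_topology UNIV) UNIV)
     {\<omega> :: 'd::finite dseq. subcube \<omega> n m \<notin> C}"
proof -
  let ?X = "product_topology (\<lambda>_ :: int ^ 'd. discrete_topology (UNIV :: bool set)) UNIV"
  have "openin ?X {\<omega>. subcube \<omega> n m \<in> C}"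
  proof (subst openin_subopen, intro ballI)
    fix \<omega> :: "'d dseq" assume \<omega>: "\<omega> \<in> {\<omega>. subcube \<omega> n m \<in> C}"
    let ?T = "\<Pi>\<^sub>E y\<in>UNIV. if y \<in> cube_at n m then {\<omega> y} else UNIV"
    have "finite (cube_at n m)"
      by (simp add: cube_at_def finite_cube_box)
    then have "openin ?X ?T"
      by (intro product_topology_basis) (auto intro: finite_subset)
    moreover have "\<omega> \<in> ?T"
      by auto
    moreover have "?T \<subseteq> {\<omega>. subcube \<omega> n m \<in> C}"
    proof
      fix \<omega>' assume "\<omega>' \<in> ?T"
      then have "\<omega>' y = \<omega> y" if "y \<in> cube_at n m" for y
        using that by (auto simp: PiE_def Pi_def split: if_splits)
      then have "subcube \<omega>' n m = subcube \<omega> n m"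
        by (auto simp: subcube_def cube_at_def restrict_def fun_eq_iff)
      with \<omega> show "\<omega>' \<in> {\<omega>. subcube \<omega> n m \<in> C}"
        by simp
    qed
    ultimately show "\<exists>T. openin ?X T \<and> \<omega> \<in> T \<and> T \<subseteq> {\<omega>. subcube \<omega> n m \<in> C}"
      by blast
  qed
  moreover have "topspace ?X - {\<omega>. subcube \<omega> n m \<notin> C} = {\<omega>. subcube \<omega> n m \<in> C}"
    by auto
  ultimately show ?thesis
    by (simp add: closedin_def)
qed

text \<open>By Tychonoff the space of sequences is compact, so closed avoidance conditions with the
  finite intersection property have a common point.\<close>

lemma avoiding_compactness:
  fixes F :: "nat \<Rightarrow> (int ^ 'd::finite \<Rightarrow> bool) set"
  assumes fin: "\<And>J. finite J \<Longrightarrow> J \<subseteq> I \<Longrightarrow> \<exists>\<omega> :: 'd dseq. \<forall>(n, m)\<in>J. subcube \<omega> n m \<notin> F n"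
  shows "\<exists>\<omega> :: 'd dseq. \<forall>(n, m)\<in>I. subcube \<omega> n m \<notin> F n"
proof -
  let ?X = "product_topology (\<lambda>_ :: int ^ 'd. discrete_topology (UNIV :: bool set)) UNIV"
  let ?D = "\<lambda>(n, m). {\<omega> :: 'd dseq. subcube \<omega> n m \<notin> F n}"
  have "compact_space ?X"
    by (simp add: compact_space_product_topology compact_space_discrete_topology)
  moreover have "\<forall>C\<in>?D ` I. closedin ?X C"
    using closedin_avoiding by auto
  moreover have "\<Inter>\<F> \<noteq> {}" if \<F>: "finite \<F>" "\<F> \<subseteq> ?D ` I" for \<F>
  proof -
    obtain J where J: "J \<subseteq> I" "finite J" "\<F> = ?D ` J"
      using finite_subset_image[OF \<F>] by blast
    obtain \<omega> :: "'d dseq" where "\<forall>(n, m)\<in>J. subcube \<omega> n m \<notin> F n"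
      using fin[OF J(2,1)] by blast
    then have "\<omega> \<in> \<Inter>\<F>"
      using J by auto
    then show ?thesis
      by blast
  qed
  ultimately have "\<Inter>(?D ` I) \<noteq> {}"
    unfolding compact_space_fip by blast
  then show ?thesis
    by auto
qed

text \<open>The map \<open>n ^ d\<close> is injective and does not decrease \<open>n\<close>, so the
  sum over sides is part of a tail of the series over all naturals. This reduces every dimension to
  one series.\<close>

lemma sum_power_image_le:
  fixes g :: "nat \<Rightarrow> real"
  assumes "\<And>k. 0 \<le> g k" "finite N" "0 < d" "\<And>n. n \<in> N \<Longrightarrow> L < n"
  shows "\<exists>M. (\<Sum>n\<in>N. g (n ^ d)) \<le> sum g {L..<M}"
proof -
  have "inj_on (\<lambda>n. n ^ d) N"
    using assms(3) by (auto intro!: inj_onI simp: power_eq_iff_eq_base)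
  then have "(\<Sum>n\<in>N. g (n ^ d)) = sum g ((\<lambda>n. n ^ d) ` N)"
    by (simp add: sum.reindex)
  moreover have "(\<lambda>n. n ^ d) ` N \<subseteq> {L..<Suc (Max ((\<lambda>n. n ^ d) ` N))}"
  proof -
    have "L \<le> n ^ d" if "n \<in> N" for n
      using assms(3) assms(4)[OF that] self_le_power[of n d] by linarith
    then show ?thesis
      using assms(2) by (auto simp: less_Suc_eq_le)
  qed
  ultimately show ?thesis
    using assms(1) by (metis sum_mono2 finite_atLeastLessThan)
qed

lemma summable_times_power:
  fixes q :: real
  assumes "0 \<le> q" "q < 1"
  shows "summable (\<lambda>k. real k * q ^ k)"
proof -
  \<comment> \<open>The geometric series is differentiated termwise inside its radius of
    convergence; multiplying by \<open>q\<close> and shifting the index gives the claim.\<close>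
  have "summable (\<lambda>k. diffs (\<lambda>_. 1) k * q ^ k)"
    by (rule termdiff_converges[of q 1]) (use assms in \<open>auto intro!: summable_geometric\<close>)
  then have "summable (\<lambda>k. q * (real (Suc k) * q ^ k))"
    by (intro summable_mult) (simp add: diffs_def)
  then have "summable (\<lambda>k. real (Suc k) * q ^ Suc k)"
    by (simp add: mult_ac)
  then show ?thesis
    by (subst (asm) summable_Suc_iff)
qed

theorem proposition4:
  fixes \<alpha> :: real
    and F :: "nat \<Rightarrow> (int ^ 'd::finite \<Rightarrow> bool) set"
  assumes "0 < \<alpha>" and "\<alpha> < 1"
    and "\<And>n. n > 1 \<Longrightarrow> F n \<subseteq> binary_cubes n"
    and "\<And>n. n > 1 \<Longrightarrow> real (card (F n)) \<le> 2 powr (\<alpha> * real n ^ CARD('d))"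
  shows "\<exists>(L::nat) (\<omega> :: 'd dseq). \<forall>n>L. \<forall>m. subcube \<omega> n m \<notin> F n"
proof -
  let ?d = "CARD('d)"
  \<comment> \<open>The exponent is the midpoint of \<alpha> and 1, which puts \<beta> strictly
    between \<open>2 powr \<alpha>\<close> and 2. So \<open>q < 1\<close>, and
    \<open>g (n ^ d)\<close> combines the \<open>n ^ d\<close> cubes through a point with the decay
    per cube.\<close>
  define \<beta> :: real where "\<beta> = 2 powr ((1 + \<alpha>) / 2)"
  define q :: real where "q = 2 powr \<alpha> / \<beta>"
  define g where "g k = real k * q ^ k" for k
  have \<beta>: "0 < \<beta>" "2 powr \<alpha> < \<beta>" "\<beta> < 2"
    using assms(1,2) powr_less_mono[of "(1 + \<alpha>) / 2" 1 2] by (auto simp: \<beta>_def)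
  have q: "0 \<le> q" "q < 1"
    using \<beta> by (auto simp: q_def)
  have g: "0 \<le> g k" for k
    using q by (simp add: g_def)
  have "summable g"
    unfolding g_def by (rule summable_times_power[OF q])
  \<comment> \<open>The Cauchy tolerance is the slack \<open>2 - \<beta>\<close> divided by \<beta>,
    to absorb the factor \<beta> left over from the exponent \<open>n ^ d - 1\<close>.\<close>
  then obtain L0 where L0: "\<And>l M. l \<ge> L0 \<Longrightarrow> norm (sum g {l..<M}) < (2 - \<beta>) / \<beta>"
    using \<beta> unfolding summable_Cauchy by (meson diff_gt_0_iff_gt divide_pos_pos)
  \<comment> \<open>The maximum with 1 ensures that sides above \<open>L\<close> satisfy the
    hypotheses on \<open>F\<close>, which are given only for \<open>n > 1\<close>.\<close>
  define L where "L = max 1 L0"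
  define I :: "(nat \<times> (int ^ 'd)) set" where "I = {(n, m). L < n}"
  have finF: "finite (F n)" if "L < n" for n
    using assms(3)[of n] that finite_binary_cubes by (auto simp: L_def intro: finite_subset)
  have cardF: "real (card (F n)) / \<beta> ^ (n ^ ?d - 1) \<le> \<beta> * q ^ (n ^ ?d)" if "L < n" for n
  proof -
    have "0 < n ^ ?d"
      using that by simp
    then have "\<beta> ^ (n ^ ?d) = \<beta> * \<beta> ^ (n ^ ?d - 1)"
      by (metis Suc_diff_1 power_Suc)
    moreover have "2 powr (\<alpha> * real n ^ ?d) = (2 powr \<alpha>) ^ (n ^ ?d)"
      by (simp add: powr_powr[symmetric] powr_realpow flip: of_nat_power)
    moreover have "real (card (F n)) \<le> 2 powr (\<alpha> * real n ^ ?d)"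
      using assms(4)[of n] that by (simp add: L_def)
    ultimately show ?thesis
      using \<beta> by (simp add: q_def power_divide field_simps)
  qed
  have "\<exists>\<omega> :: 'd dseq. \<forall>(n, m)\<in>J. subcube \<omega> n m \<notin> F n" if J: "finite J" "J \<subseteq> I" for J
  proof -
    let ?A = "\<lambda>(n, m). cube_at n m :: (int ^ 'd) set"
    let ?P = "\<lambda>(n, m). patterns_at (F n) n m"
    have gtL: "L < n" if "(n, m) \<in> J" for n m
      using that J by (auto simp: I_def)
    have "\<exists>f. \<forall>j\<in>J. restrict f (?A j) \<notin> ?P j"
    proof (rule exists_avoiding_colouring[OF J(1) _ _ \<beta>(1)])
      fix j assume j: "j \<in> J"
      obtain n m where nm: "j = (n, m)" "L < n"
        using j gtL by (cases j) auto
      have "card (?A j) > 0"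
        using nm by (simp add: card_cube_at)
      then show "finite (?A j) \<and> ?A j \<noteq> {}"
        by (simp add: card_gt_0_iff)
      show "finite (?P j)"
        using nm finF by (simp add: patterns_at_card_le)
    next
      fix x
      let ?K = "{j. j \<in> J \<and> x \<in> ?A j}"
      let ?N = "fst ` J"
      \<comment> \<open>All cubes through \<open>x\<close> whose side occurs in \<open>J\<close>:
        still a finite set, but now a full family of \<open>n ^ d\<close> equal terms for each side
        \<open>n\<close>.\<close>
      let ?Z = "Sigma ?N (\<lambda>n. {m. x \<in> cube_at n m})"
      have "(\<Sum>j\<in>?K. real (card (?P j)) / \<beta> ^ (card (?A j) - 1))
          \<le> (\<Sum>j\<in>?K. \<beta> * q ^ (fst j ^ ?d))"
      proof (rule sum_mono)
        fix j assume j: "j \<in> ?K"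
        obtain n m where nm: "j = (n, m)" "L < n"
          using j gtL by (cases j) auto
        have "real (card (patterns_at (F n) n m)) / \<beta> ^ (n ^ ?d - 1)
            \<le> real (card (F n)) / \<beta> ^ (n ^ ?d - 1)"
          using \<beta> patterns_at_card_le(2)[OF finF[OF nm(2)]] by (intro divide_right_mono) auto
        also have "\<dots> \<le> \<beta> * q ^ (n ^ ?d)"
          by (rule cardF[OF nm(2)])
        finally show "real (card (?P j)) / \<beta> ^ (card (?A j) - 1) \<le> \<beta> * q ^ (fst j ^ ?d)"
          using nm by (simp add: card_cube_at)
      qed
      also have "\<dots> \<le> (\<Sum>j\<in>?Z. \<beta> * q ^ (fst j ^ ?d))"
      proof (rule sum_mono2)
        show "finite ?Z"
          using J by (intro finite_SigmaI finite_cubes_through) auto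
        show "?K \<subseteq> ?Z"
          by force
      qed (use \<beta> q in auto)
      also have "\<dots> = (\<Sum>n\<in>?N. \<Sum>m | x \<in> cube_at n m. \<beta> * q ^ (n ^ ?d))"
        using J by (subst sum.Sigma) (auto intro: finite_cubes_through intro!: sum.cong)
      also have "\<dots> = \<beta> * (\<Sum>n\<in>?N. g (n ^ ?d))"
        by (simp add: card_cubes_through g_def sum_distrib_left mult_ac)
      also have "\<dots> \<le> \<beta> * ((2 - \<beta>) / \<beta>)"
      proof -
        obtain M where "(\<Sum>n\<in>?N. g (n ^ ?d)) \<le> sum g {L..<M}"
          using sum_power_image_le[of g ?N ?d L] g J(1) gtL by fastforce
        moreover have "sum g {L..<M} < (2 - \<beta>) / \<beta>"
          using L0[of L M] by (simp add: L_def)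
        ultimately show ?thesis
          using \<beta> by (intro mult_left_mono) auto
      qed
      finally show "\<beta> + (\<Sum>j\<in>?K. real (card (?P j)) / \<beta> ^ (card (?A j) - 1)) \<le> 2"
        using \<beta> by simp
    qed
    then show ?thesis
      by (auto simp: subcube_in_iff)
  qed
  \<comment> \<open>The threshold \<open>L\<close> was fixed before the finite family
    \<open>J\<close>, so it serves all finite families and compactness applies to the whole of
    \<open>I\<close>.\<close>
  from avoiding_compactness[OF this]
  obtain \<omega> :: "'d dseq" where "\<forall>(n, m)\<in>I. subcube \<omega> n m \<notin> F n"
    by blast
  then have "\<forall>n>L. \<forall>m. subcube \<omega> n m \<notin> F n"
    by (auto simp: I_def)
  then show ?thesis
    by blast
qed

end
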